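(* In the ERI space $X=(X_0,\tau_{\mathrm{ERI}})$, the tightness at $\ast$ satisfies $t(\ast,X)=\aleph_0$, while the character at $\ast$ satisfies $\chi(\ast,X)\geq\aleph_1$.
   Context: Let $\overline{\mathbb{R}}=[-\infty,+\infty]$ be the extended real line with its order topology. Let $\sim$ be the equivalence relation on $\overline{\mathbb{R}}$ whose only non-singleton class is $\{-\infty,0,+\infty\}$, let $X_0=\overline{\mathbb{R}}/{\sim}$ be the quotient set, $q\colon\overline{\mathbb{R}}\to X_0$ the projection, and $\ast=q(-\infty)=q(0)=q(+\infty)$. The ERI topology $\tau_{\mathrm{ERI}}$ on $X_0$ consists of all $U\subseteq X_0$ such that (a) $q^{-1}(U)$ is open in $\overline{\mathbb{R}}$, and (b) if $\ast\in U$ then $q^{-1}(U)$ is dense in $\overline{\mathbb{R}}$. (This is a topology.) The ERI space is $X=(X_0,\tau_{\mathrm{ERI}})$. The tightness $t(x,X)$ of a space $X$ at a point $x$ is the least cardinal $\kappa$ such that whenever $x\in\overline{S}$ with $S\subseteq X$, there is $S_0\subseteq S$ with $|S_0|\leq\kappa$ and $x\in\overline{S_0}$. The character $\chi(x,X)$ is the least cardinality of a neighborhood base at $x$. *)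

theory Defs
  imports "HOL-Analysis.Analysis"
begin

unbundle cardinal_syntax
no_notation elt_set_eq (infix "=o" 50) (* clashes with cardinal equality *)

text \<open>Cardinals are relations satisfying \<^const>\<open>Card_order\<close>, compared up to \<open>=o\<close>;
  in particular \<^const>\<open>natLeq\<close> is \<open>\<aleph>\<^sub>0\<close> and \<^term>\<open>cardSuc natLeq\<close> is \<open>\<aleph>\<^sub>1\<close>.
  Finite cardinals are included, so tightness and character below are not forced to be infinite.

  The least cardinal with property \<open>P\<close> is sought among the cardinals on one type \<^typ>\<open>'b\<close>. If some
  cardinal on \<^typ>\<open>'b\<close> satisfies \<open>P\<close> then this is no restriction (for \<open>P\<close> invariant under \<open>=o\<close>),
  since each smaller cardinal is \<open>=o\<close> to one on \<^typ>\<open>'b\<close>. The result is unique up to \<open>=o\<close>.\<close>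

definition least_cardinal :: "('b rel \<Rightarrow> bool) \<Rightarrow> 'b rel" where
  "least_cardinal P =
     (SOME \<kappa>. Card_order \<kappa> \<and> P \<kappa> \<and> (\<forall>\<kappa>'. Card_order \<kappa>' \<and> P \<kappa>' \<longrightarrow> \<kappa> \<le>o \<kappa>'))"

lemma least_cardinal:
  assumes "Card_order \<kappa>" "P \<kappa>"
  shows "Card_order (least_cardinal P)" "P (least_cardinal P)"
    and "\<And>\<kappa>'. Card_order \<kappa>' \<Longrightarrow> P \<kappa>' \<Longrightarrow> least_cardinal P \<le>o \<kappa>'"
proof -
  let ?R = "{r. Card_order r \<and> P r}"
  have "?R \<noteq> {}" "\<forall>r\<in>?R. Well_order r"
    using assms by (auto simp: card_order_on_well_order_on)
  from exists_minim_Well_order[OF this]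
  have "\<exists>\<kappa>. Card_order \<kappa> \<and> P \<kappa> \<and> (\<forall>\<kappa>'. Card_order \<kappa>' \<and> P \<kappa>' \<longrightarrow> \<kappa> \<le>o \<kappa>')"
    by blast
  from someI_ex[OF this]
  show "Card_order (least_cardinal P)" "P (least_cardinal P)"
    and "\<And>\<kappa>'. Card_order \<kappa>' \<Longrightarrow> P \<kappa>' \<Longrightarrow> least_cardinal P \<le>o \<kappa>'"
    unfolding least_cardinal_def by blast+
qed

definition tightness_bound :: "'a topology \<Rightarrow> 'a \<Rightarrow> 'b rel \<Rightarrow> bool" where
  "tightness_bound X x \<kappa> \<longleftrightarrow>
     (\<forall>S \<subseteq> topspace X. x \<in> X closure_of S \<longrightarrow>
        (\<exists>S0 \<subseteq> S. |S0| \<le>o \<kappa> \<and> x \<in> X closure_of S0))"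

text \<open>The cardinals on the type of points suffice here: \<open>|topspace X|\<close> is always a bound.\<close>

definition tightness :: "'a topology \<Rightarrow> 'a \<Rightarrow> 'a rel" where
  "tightness X x = least_cardinal (tightness_bound X x)"

lemma tightness_bound_topspace: "tightness_bound X x |topspace X|"
  unfolding tightness_bound_def by (meson card_of_mono1 subset_refl)

lemmas tightness_least =
  least_cardinal[where P = "tightness_bound X x" for X x,
    OF card_of_Card_order tightness_bound_topspace, folded tightness_def]

definition neighbourhood :: "'a topology \<Rightarrow> 'a \<Rightarrow> 'a set \<Rightarrow> bool" where
  "neighbourhood X x N \<longleftrightarrow> N \<subseteq> topspace X \<and> (\<exists>U. openin X U \<and> x \<in> U \<and> U \<subseteq> N)"

definition neighbourhood_base :: "'a topology \<Rightarrow> 'a \<Rightarrow> 'a set set \<Rightarrow> bool" where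
  "neighbourhood_base X x B \<longleftrightarrow>
     (\<forall>V\<in>B. neighbourhood X x V) \<and> (\<forall>N. neighbourhood X x N \<longrightarrow> (\<exists>V\<in>B. V \<subseteq> N))"

definition character :: "'a topology \<Rightarrow> 'a \<Rightarrow> 'a set rel" where
  "character X x = least_cardinal (\<lambda>\<kappa>. \<exists>B. neighbourhood_base X x B \<and> |B| =o \<kappa>)"

lemma neighbourhood_base_all: "neighbourhood_base X x {N. neighbourhood X x N}"
  unfolding neighbourhood_base_def by blast

lemma character_least:
  shows "\<exists>B. neighbourhood_base X x B \<and> |B| =o character X x"
    and "\<And>B. neighbourhood_base X x B \<Longrightarrow> character X x \<le>o |B|"
proof -
  have *: "\<exists>B'. neighbourhood_base X x B' \<and> |B'| =o |B|" if "neighbourhood_base X x B" for B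
    using that card_of_refl by blast
  note least = least_cardinal[where P = "\<lambda>\<kappa>. \<exists>B. neighbourhood_base X x B \<and> |B| =o \<kappa>",
    OF card_of_Card_order *[OF neighbourhood_base_all], folded character_def]
  show "\<exists>B. neighbourhood_base X x B \<and> |B| =o character X x"
    by (rule least(2))
  show "\<And>B. neighbourhood_base X x B \<Longrightarrow> character X x \<le>o |B|"
    by (rule least(3)[OF card_of_Card_order *])
qed

definition eri_rel :: "ereal rel" where
  "eri_rel = {(x, y). x = y \<or> (x \<in> {-\<infinity>, 0, \<infinity>} \<and> y \<in> {-\<infinity>, 0, \<infinity>})}"

lemma equiv_eri_rel: "equiv UNIV eri_rel"
  by (rule equivI) (auto simp: eri_rel_def refl_on_def sym_def trans_def)

definition eri_points :: "ereal set set" where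
  "eri_points = UNIV // eri_rel"

definition eri_proj :: "ereal \<Rightarrow> ereal set" where
  "eri_proj x = eri_rel `` {x}"

definition eri_star :: "ereal set" where
  "eri_star = eri_proj 0"

lemma eri_star_eq: "eri_proj (-\<infinity>) = eri_star" "eri_proj \<infinity> = eri_star"
  by (auto simp: eri_star_def eri_proj_def eri_rel_def)

definition eri_open :: "ereal set set \<Rightarrow> bool" where
  "eri_open U \<longleftrightarrow> U \<subseteq> eri_points \<and> open (eri_proj -` U) \<and>
     (eri_star \<in> U \<longrightarrow> closure (eri_proj -` U) = UNIV)"

definition ERI :: "ereal set topology" where
  "ERI = topology eri_open"

lemma istopology_eri_open: "istopology eri_open"
  unfolding istopology_def
proof (intro conjI allI impI)
  fix S T assume S: "eri_open S" and T: "eri_open T"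
  have "closure (eri_proj -` S \<inter> eri_proj -` T) = UNIV" if "eri_star \<in> S \<inter> T"
  proof -
    have "eri_proj -` S \<subseteq> closure (eri_proj -` S \<inter> eri_proj -` T)"
      using S T that open_Int_closure_subset[of "eri_proj -` S" "eri_proj -` T"]
      by (auto simp: eri_open_def)
    then have "closure (eri_proj -` S) \<subseteq> closure (eri_proj -` S \<inter> eri_proj -` T)"
      by (simp add: closure_minimal)
    then show ?thesis
      using S that by (auto simp: eri_open_def)
  qed
  with S T show "eri_open (S \<inter> T)"
    by (auto simp: eri_open_def vimage_Int open_Int)
next
  fix \<K> assume K: "\<forall>K\<in>\<K>. eri_open K"
  have "open (eri_proj -` \<Union>\<K>)"
    using K by (auto simp: eri_open_def vimage_Union)
  moreover have "closure (eri_proj -` \<Union>\<K>) = UNIV" if "eri_star \<in> \<Union>\<K>"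
  proof -
    from that obtain K where "K \<in> \<K>" "eri_star \<in> K" by blast
    moreover from this have "closure (eri_proj -` K) \<subseteq> closure (eri_proj -` \<Union>\<K>)"
      by (intro closure_mono) auto
    ultimately show ?thesis
      using K by (auto simp: eri_open_def)
  qed
  ultimately show "eri_open (\<Union>\<K>)"
    using K by (auto simp: eri_open_def)
qed

lemma openin_ERI: "openin ERI = eri_open"
  unfolding ERI_def by (rule topology_inverse'[OF istopology_eri_open])

lemma topspace_ERI: "topspace ERI = eri_points"
proof -
  have "eri_proj -` eri_points = UNIV"
    by (auto simp: eri_points_def eri_proj_def quotientI)
  then have "eri_open eri_points"
    by (simp add: eri_open_def)
  moreover have "eri_open U \<Longrightarrow> U \<subseteq> eri_points" for U
    by (simp add: eri_open_def)
  ultimately show ?thesis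
    unfolding topspace_def openin_ERI by blast
qed

end

theory Submission
  imports Defs "HOL-Library.Countable_Set_Type"
begin

text \<open>A set missing \<open>\<ast>\<close> has \<open>\<ast>\<close> in its closure unless its preimage in the extended reals is
  nowhere dense with closure avoiding \<open>-\<infinity>, 0, \<infinity>\<close>. This depends only on the closure of the
  preimage, so a countable dense subset of the preimage witnesses countable tightness; the points
  \<open>1/n\<close> show that finite subsets do not suffice. Given countably many neighbourhoods of
  \<open>\<ast>\<close>, pick a point of each so that these points converge to \<open>1\<close>: removing the sequence and
  its limit leaves a neighbourhood of \<open>\<ast>\<close> that contains none of the given ones.\<close>

section \<open>Countable subsets and open sets of the extended reals\<close>

lemma countable_dense_subset:
  fixes S :: "'a::second_countable_topology set"
  obtains D where "countable D" "D \<subseteq> S" "S \<subseteq> closure D"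
proof -
  obtain \<B> :: "'a set set" where \<B>: "countable \<B>" "topological_basis \<B>"
    using ex_countable_basis by blast
  let ?\<B> = "{b \<in> \<B>. b \<inter> S \<noteq> {}}"
  \<comment> \<open>One point is chosen from each basic set that meets \<open>S\<close>. A basic
    neighbourhood of a point of \<open>S\<close> meets \<open>S\<close> in that point, so it
    contains a chosen point and cannot miss the closure.\<close>
  let ?D = "(\<lambda>b. SOME x. x \<in> b \<inter> S) ` ?\<B>"
  have some: "(SOME x. x \<in> b \<inter> S) \<in> b \<inter> S" if "b \<in> ?\<B>" for b
    by (rule someI_ex) (use that in blast)
  have "countable ?D"
    using \<B>(1) by simp
  moreover have "?D \<subseteq> S"
    using some by blast
  moreover have "x \<in> closure ?D" if "x \<in> S" for x
  proof (rule ccontr)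
    assume "x \<notin> closure ?D"
    then obtain b where b: "b \<in> \<B>" "x \<in> b" "b \<subseteq> - closure ?D"
      using topological_basisE[OF \<B>(2), of "- closure ?D" x] by auto
    then have "b \<in> ?\<B>"
      using that by blast
    then have "(SOME x. x \<in> b \<inter> S) \<in> b" "(SOME x. x \<in> b \<inter> S) \<in> closure ?D"
      using some[of b] closure_subset[of ?D] by blast+
    then show False
      using b(3) by blast
  qed
  ultimately show thesis
    using that[of ?D] by blast
qed

text \<open>Every neighbourhood of an infinite point contains a ray, hence a real, so the trace of
  \<open>V\<close> on the reals is open and nonempty; such sets of reals are uncountable.\<close>

lemma uncountable_open_ereal:
  fixes V :: "ereal set"
  assumes "open V" "V \<noteq> {}"
  shows "uncountable V"
proof
  assume "countable V"
  obtain x where "x \<in> V"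
    using assms(2) by blast
  obtain r where r: "ereal r \<in> V"
  proof (cases x)
    case (real r)
    then show ?thesis using that \<open>x \<in> V\<close> by simp
  next
    case PInf
    then obtain B where "{ereal B<..} \<subseteq> V"
      using open_PInfty[OF assms(1)] \<open>x \<in> V\<close> by auto
    then show ?thesis using that[of "B + 1"] by (auto simp: subset_iff)
  next
    case MInf
    then obtain B where "{..<ereal B} \<subseteq> V"
      using open_MInfty[OF assms(1)] \<open>x \<in> V\<close> by auto
    then show ?thesis using that[of "B - 1"] by (auto simp: subset_iff)
  qed
  have "countable (ereal -` V)"
    using countable_image_inj_on[of ereal "ereal -` V"] \<open>countable V\<close>
    by (meson countable_subset image_vimage_subset inj_on_def ereal.inject)
  moreover have "open (ereal -` V)"
    using assms(1) by (rule open_ereal_vimage)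
  ultimately show False
    \<comment> \<open>A countable trace, removed from itself, would still have to leave a
      point.\<close>
    using r open_minus_countable[of "ereal -` V" "ereal -` V"] by blast
qed

text \<open>This supplies neighbourhoods of \<open>eri_star\<close>: removing a countable closed set
  that avoids the three identified points keeps the preimage open and dense.\<close>

lemma dense_complement_of_countable_ereal:
  fixes C :: "ereal set"
  assumes "countable C"
  shows "closure (- C) = UNIV"
proof -
  have "interior C = {}"
    using assms uncountable_open_ereal[OF open_interior[of C]] countable_subset[OF interior_subset]
    by blast
  then show ?thesis
    by (simp add: closure_complement)
qed

section \<open>Passing between the quotient and the extended reals\<close>

lemma eri_proj_eq_iff:
  "eri_proj x = eri_proj y \<longleftrightarrow> x = y \<or> (x \<in> {-\<infinity>, 0, \<infinity>} \<and> y \<in> {-\<infinity>, 0, \<infinity>})"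
  unfolding eri_proj_def
  by (subst eq_equiv_class_iff[OF equiv_eri_rel]) (auto simp: eri_rel_def)

lemma eri_proj_in_points: "eri_proj x \<in> eri_points"
  by (auto simp: eri_points_def eri_proj_def quotientI)

lemma eri_star_in_points: "eri_star \<in> eri_points"
  unfolding eri_star_def by (rule eri_proj_in_points)

text \<open>Such a \<open>V\<close> is saturated: it contains the only nontrivial class, and all
  other fibres are singletons.\<close>

lemma vimage_eri_proj_image:
  assumes "{-\<infinity>, 0, \<infinity>} \<subseteq> V"
  shows "eri_proj -` (eri_proj ` V) = V"
  using assms by (auto simp: eri_proj_eq_iff)

lemma eri_open_image:
  assumes "open V" "closure V = UNIV" "{-\<infinity>, 0, \<infinity>} \<subseteq> V"
  shows "eri_open (eri_proj ` V)"
  using assms eri_proj_in_points by (auto simp: eri_open_def vimage_eri_proj_image)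

lemma eri_open_star:
  assumes "eri_open U" "eri_star \<in> U"
  shows "open (eri_proj -` U)" "closure (eri_proj -` U) = UNIV" "{-\<infinity>, 0, \<infinity>} \<subseteq> eri_proj -` U"
  using assms by (auto simp: eri_open_def eri_star_eq eri_star_def)

text \<open>Image and preimage under \<open>eri_proj\<close> match the open sets around
  \<open>eri_star\<close> with the dense open sets containing its three preimages, so closure at
  \<open>eri_star\<close> can be tested in the extended reals.\<close>

lemma eri_star_closure_iff:
  "eri_star \<in> ERI closure_of S \<longleftrightarrow>
     (\<forall>V. open V \<and> closure V = UNIV \<and> {-\<infinity>, 0, \<infinity>} \<subseteq> V \<longrightarrow> V \<inter> eri_proj -` S \<noteq> {})"
    (is "?L \<longleftrightarrow> ?R")
proof
  assume L: ?L
  show ?R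
  proof (intro allI impI, elim conjE)
    fix V :: "ereal set"
    assume V: "open V" "closure V = UNIV" "{-\<infinity>, 0, \<infinity>} \<subseteq> V"
    have "eri_star \<in> eri_proj ` V"
      using V(3) by (auto simp: eri_star_def)
    then obtain y where "y \<in> S" "y \<in> eri_proj ` V"
      using L eri_open_image[OF V] unfolding in_closure_of openin_ERI by blast
    then show "V \<inter> eri_proj -` S \<noteq> {}"
      by auto
  qed
next
  assume R: ?R
  have "\<exists>y. y \<in> S \<and> y \<in> U" if "eri_star \<in> U" "eri_open U" for U
    using R[rule_format, of "eri_proj -` U"] eri_open_star[OF that(2,1)] by blast
  then show ?L
    by (auto simp: in_closure_of openin_ERI topspace_ERI eri_star_in_points)
qed

section \<open>Tightness at the collapsed point\<close>

lemma tightness_bound_ERI: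
  assumes "natLeq \<le>o \<kappa>"
  shows "tightness_bound ERI eri_star \<kappa>"
  unfolding tightness_bound_def
proof (intro allI impI)
  fix S
  assume S: "S \<subseteq> topspace ERI" "eri_star \<in> ERI closure_of S"
  obtain D where D: "countable D" "D \<subseteq> eri_proj -` S" "eri_proj -` S \<subseteq> closure D"
    by (rule countable_dense_subset)
  have "V \<inter> eri_proj -` (eri_proj ` D) \<noteq> {}"
    if "open V" "closure V = UNIV" "{-\<infinity>, 0, \<infinity>} \<subseteq> V" for V
  proof -
    \<comment> \<open>An open set that meets the closure of \<open>D\<close> meets \<open>D\<close>,
      so \<open>D\<close> can replace the whole preimage of \<open>S\<close>.\<close>
    have "V \<inter> closure D \<noteq> {}"
      using S(2)[unfolded eri_star_closure_iff, rule_format, of V] D(3) that by blast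
    then show ?thesis
      using open_Int_closure_eq_empty[OF that(1), of D] by blast
  qed
  then have "eri_star \<in> ERI closure_of (eri_proj ` D)"
    unfolding eri_star_closure_iff by blast
  moreover have "|eri_proj ` D| \<le>o natLeq"
    using D(1) by (simp add: countable_card_le_natLeq[symmetric])
  then have "|eri_proj ` D| \<le>o \<kappa>"
    using assms by (rule ordLeq_transitive)
  ultimately show "\<exists>S0\<subseteq>S. |S0| \<le>o \<kappa> \<and> eri_star \<in> ERI closure_of S0"
    using D(2) by (intro exI[of _ "eri_proj ` D"]) auto
qed

text \<open>The complement of \<open>C\<close> projects to an open set around
  \<open>eri_star\<close> that misses \<open>S\<close>.\<close>

lemma eri_star_notin_closure:
  assumes "countable C" "closed C" "C \<inter> {-\<infinity>, 0, \<infinity>} = {}" "eri_proj -` S \<subseteq> C"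
  shows "eri_star \<notin> ERI closure_of S"
proof -
  have "open (- C)" "closure (- C) = UNIV" "{-\<infinity>, 0, \<infinity>} \<subseteq> - C" "- C \<inter> eri_proj -` S = {}"
    using assms dense_complement_of_countable_ereal by auto
  then show ?thesis
    unfolding eri_star_closure_iff by blast
qed

lemma infinite_tightness_bound_ERI:
  assumes "Card_order \<kappa>" "tightness_bound ERI eri_star \<kappa>"
  shows "natLeq \<le>o \<kappa>"
proof (rule ccontr)
  assume "\<not> natLeq \<le>o \<kappa>"
  then have \<kappa>: "\<kappa> <o natLeq"
    using assms(1) natLeq_Well_order not_ordLeq_iff_ordLess card_order_on_well_order_on by blast
  \<comment> \<open>Convergence to 0 puts \<open>eri_star\<close> in the closure of the image of the
    sequence, while a finite subset of the sequence is closed and avoids 0 and both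
    infinities.\<close>
  define p where "p n = ereal (inverse (real (Suc n)))" for n
  let ?S = "eri_proj ` range p"
  have p0: "p \<longlonglongrightarrow> 0"
    unfolding p_def zero_ereal_def using LIMSEQ_inverse_real_of_nat by simp
  have p_notin: "p n \<notin> {-\<infinity>, 0, \<infinity>}" for n
    by (simp add: p_def)
  have "V \<inter> eri_proj -` ?S \<noteq> {}" if "open V" "{-\<infinity>, 0, \<infinity>} \<subseteq> V" for V
  proof -
    have "\<forall>\<^sub>F n in sequentially. p n \<in> V"
      using p0 that by (intro topological_tendstoD) auto
    then show ?thesis
      by (auto simp: eventually_sequentially)
  qed
  then have "eri_star \<in> ERI closure_of ?S"
    unfolding eri_star_closure_iff by blast
  moreover have "?S \<subseteq> topspace ERI"
    using eri_proj_in_points by (auto simp: topspace_ERI)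
  ultimately have "\<exists>S0\<subseteq>?S. |S0| \<le>o \<kappa> \<and> eri_star \<in> ERI closure_of S0"
    using assms(2) by (simp only: tightness_bound_def)
  then obtain S0 where S0: "S0 \<subseteq> ?S" "|S0| \<le>o \<kappa>" "eri_star \<in> ERI closure_of S0"
    by (elim exE conjE)
  have "finite S0"
    using S0(2) \<kappa> ordLeq_ordLess_trans finite_iff_ordLess_natLeq by blast
  then obtain F where F: "finite F" "F \<subseteq> range p" "S0 = eri_proj ` F"
    using finite_subset_image[OF _ S0(1)] by blast
  have "eri_proj -` S0 \<subseteq> F"
    using F p_notin by (auto simp: eri_proj_eq_iff)
  moreover have "F \<inter> {-\<infinity>, 0, \<infinity>} = {}"
  proof (rule equals0I)
    fix x
    assume x: "x \<in> F \<inter> {-\<infinity>, 0, \<infinity>}"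
    then obtain n where "x = p n"
      using F(2) by auto
    then show False
      using x p_notin[of n] by simp
  qed
  ultimately have "eri_star \<notin> ERI closure_of S0"
    using F(1) by (intro eri_star_notin_closure[of F])
      (auto intro: countable_finite finite_imp_closed)
  then show False
    using S0(3) by blast
qed

lemma tightness_ERI: "tightness ERI eri_star =o natLeq"
proof -
  \<comment> \<open>\<open>tightness\<close> is a least cardinal on the type of points, where
    \<open>natLeq\<close> does not live. Singletons of naturals give a copy of it on that type; they
    need not be points of the space.\<close>
  have "inj (\<lambda>n. {ereal (real n)})"
    by (auto simp: inj_def)
  then have "|UNIV :: nat set| =o |range (\<lambda>n. {ereal (real n)})|"
    using card_of_ordIsoI[OF inj_on_imp_bij_betw] by blast
  then have C: "natLeq =o |range (\<lambda>n. {ereal (real n)})|"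
    using card_of_nat ordIso_symmetric ordIso_transitive by blast
  have "tightness_bound ERI eri_star |range (\<lambda>n. {ereal (real n)})|"
    using C by (intro tightness_bound_ERI ordIso_imp_ordLeq)
  then have "tightness ERI eri_star \<le>o |range (\<lambda>n. {ereal (real n)})|"
    by (rule tightness_least(3)[OF card_of_Card_order])
  then have "tightness ERI eri_star \<le>o natLeq"
    using ordIso_symmetric[OF C] by (rule ordLeq_ordIso_trans)
  moreover have "natLeq \<le>o tightness ERI eri_star"
    by (rule infinite_tightness_bound_ERI[OF tightness_least(1,2)])
  ultimately show ?thesis
    by (simp add: ordIso_iff_ordLeq)
qed

section \<open>Character at the collapsed point\<close>

lemma uncountable_neighbourhood_base_ERI:
  assumes "neighbourhood_base ERI eri_star B"
  shows "uncountable B"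
proof
  assume "countable B"
  have nbhd: "\<exists>r. 1 < r \<and> r < 1 + inverse (real (Suc n)) \<and> eri_proj (ereal r) \<in> V"
    if "V \<in> B" for V n
  proof -
    have "neighbourhood ERI eri_star V"
      using assms that by (simp add: neighbourhood_base_def)
    then obtain U where U: "eri_open U" "eri_star \<in> U" "U \<subseteq> V"
      by (auto simp: neighbourhood_def openin_ERI)
    \<comment> \<open>The preimage of \<open>U\<close> is dense, so it meets every interval, even
      one far from the three identified points. The interval shrinks to 1, which forces the chosen
      points to converge.\<close>
    let ?I = "{ereal 1<..<ereal (1 + inverse (real (Suc n)))}"
    have "?I \<noteq> {}"
      unfolding greaterThanLessThan_empty_iff by simp
    then have "?I \<inter> eri_proj -` U \<noteq> {}"
      using open_Int_closure_eq_empty[of ?I "eri_proj -` U"] eri_open_star(2)[OF U(1,2)] by simp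
    then obtain x where x: "x \<in> ?I" "eri_proj x \<in> V"
      using U(3) by blast
    then obtain r where "x = ereal r"
      by (cases x) auto
    then show ?thesis
      using x by auto
  qed
  have "neighbourhood ERI eri_star (topspace ERI)"
    using eri_star_in_points by (auto simp: neighbourhood_def topspace_ERI[symmetric])
  then have "B \<noteq> {}"
    using assms unfolding neighbourhood_base_def by blast
  \<comment> \<open>The enumeration may repeat members, so a finite \<open>B\<close> is covered
    too.\<close>
  then have B: "range (from_nat_into B) = B"
    using \<open>countable B\<close> by (rule range_from_nat_into)
  have "\<exists>r. 1 < r \<and> r < 1 + inverse (real (Suc n)) \<and> eri_proj (ereal r) \<in> from_nat_into B n"
    for n
    by (rule nbhd[OF from_nat_into[OF \<open>B \<noteq> {}\<close>]])
  then obtain p where p: "\<And>n. 1 < p n" "\<And>n. p n < 1 + inverse (real (Suc n))"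
      "\<And>n. eri_proj (ereal (p n)) \<in> from_nat_into B n"
    by metis
  have "(\<lambda>n. 1 + inverse (real (Suc n))) \<longlonglongrightarrow> 1"
    using tendsto_add[OF tendsto_const LIMSEQ_inverse_real_of_nat, of 1] by simp
  then have "p \<longlonglongrightarrow> 1"
    by (rule tendsto_sandwich[OF _ _ tendsto_const, rotated 2])
      (use p in \<open>auto intro!: always_eventually less_imp_le\<close>)
  \<comment> \<open>Adding the limit makes the countable set compact, hence closed, so its
    complement projects to a neighbourhood of \<open>eri_star\<close>.\<close>
  define C where "C = ereal ` insert 1 (range p)"
  have "compact C"
    unfolding C_def using compact_sequence_with_limit[OF \<open>p \<longlonglongrightarrow> 1\<close>]
    by (intro compact_continuous_image continuous_on_ereal continuous_on_id)
  then have "closed C"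
    by (rule compact_imp_closed)
  have "countable C"
    by (simp add: C_def)
  have "p n \<noteq> 0" for n
    using p(1)[of n] by simp
  then have C3: "{-\<infinity>, 0, \<infinity>} \<subseteq> - C"
    by (auto simp: C_def)
  have "eri_open (eri_proj ` (- C))"
    using \<open>closed C\<close> dense_complement_of_countable_ereal[OF \<open>countable C\<close>] C3
    by (intro eri_open_image) auto
  moreover have "eri_star \<in> eri_proj ` (- C)"
    using C3 by (auto simp: eri_star_def)
  ultimately have "neighbourhood ERI eri_star (eri_proj ` (- C))"
    by (auto simp: neighbourhood_def openin_ERI topspace_ERI eri_proj_in_points)
  then obtain V where "V \<in> B" "V \<subseteq> eri_proj ` (- C)"
    using assms unfolding neighbourhood_base_def by blast
  moreover obtain n where "V = from_nat_into B n"
    using \<open>V \<in> B\<close> B by blast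
  \<comment> \<open>Diagonal contradiction: the n-th base set contains the image of
    \<open>p n\<close>, which was removed; saturation of \<open>- C\<close> carries this back to the
    extended reals.\<close>
  ultimately have "eri_proj (ereal (p n)) \<in> eri_proj ` (- C)"
    using p(3)[of n] by blast
  then have "ereal (p n) \<in> - C"
    using vimage_eri_proj_image[OF C3] by blast
  then show False
    by (simp add: C_def)
qed

lemma character_ERI: "cardSuc natLeq \<le>o character ERI eri_star"
proof -
  obtain B where B: "neighbourhood_base ERI eri_star B" "|B| =o character ERI eri_star"
    using character_least(1)[of ERI eri_star] by (elim exE conjE)
  have "natLeq <o |B|"
    using uncountable_neighbourhood_base_ERI[OF B(1)]
    by (simp add: countable_card_le_natLeq
        not_ordLeq_iff_ordLess[OF natLeq_Well_order card_of_Well_order])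
  then have "cardSuc natLeq \<le>o |B|"
    by (intro cardSuc_least natLeq_Card_order card_of_Card_order)
  then show ?thesis
    using B(2) by (rule ordLeq_ordIso_trans)
qed

theorem proposition3p16:
  shows "tightness ERI eri_star =o natLeq \<and> cardSuc natLeq \<le>o character ERI eri_star"
  using tightness_ERI character_ERI by blast

end
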